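(* Let $p\geq 2$ and let $\sigma$ be the substitution on $\{-1,1\}$ given by $\sigma(1)=v_0v_1\cdots v_{p-1}$, $\sigma(-1)=\bar v_0\bar v_1\cdots\bar v_{p-1}$, where $v_0=1$, $v_i\in\{-1,1\}$ and $\bar v_i=-v_i$. Let $\mathbf{d}\in\{-1,1\}^{\infty}$ be the fixed point of $\sigma$ starting with $1$. For $m\geq p$ define $v_m:=v_j$ where $m=np+j$ with $n\geq 0$ and $0\leq j\leq p-1$. (1) If $p$ is odd, then $\mathbf{d}$ is apwenian if and only if \[\frac{v_j+v_{j+1}-v_{2j+1}-v_{2j+2}}{2}\equiv 1\pmod 2,\quad 0\leq j\leq p-2.\] (2) If $p$ is even, then $\mathbf{d}$ is apwenian if and only if $\mathbf{d}$ is the Thue-Morse sequence, i.e. $d_0=1$, $d_{2n}=d_n$ and $d_{2n+1}=-d_n$ for all $n\geq 0$.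
   Context: For an integer sequence $\mathbf{a}$, $H_n(\mathbf{a})=\det(a_{i+j})_{0\leq i,j\leq n-1}$. A sequence $\mathbf{d}\in\{-1,1\}^{\infty}$ is apwenian if $H_n(\mathbf{d})/2^{n-1}\equiv 1\pmod 2$ for all $n\geq 1$. *)

theory Defs
  imports
    "Jordan_Normal_Form.Determinant"
    "HOL-Library.Stream"
    "HOL-Number_Theory.Cong"
begin

definition hankel_det :: "(nat \<Rightarrow> int) \<Rightarrow> nat \<Rightarrow> int" where
  "hankel_det a n = det (mat n n (\<lambda>(i, j). a (i + j)))"

(* The division is exact: see pow2_dvd_hankel_det below. *)
definition apwenian :: "(nat \<Rightarrow> int) \<Rightarrow> bool" where
  "apwenian d \<longleftrightarrow>
     (\<forall>n. d n \<in> {-1, 1}) \<and> (\<forall>n\<ge>1. [hankel_det d n div 2 ^ (n - 1) = 1] (mod 2))"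

(* sigma(d) is the infinite concatenation sigma(d_0) sigma(d_1) sigma(d_2) ...  The stream function
   flat computes it only for non-erasing sigma; flat_constant_length below gives its letters when
   all the words have the same positive length. *)
definition fixed_point :: "('a \<Rightarrow> 'a list) \<Rightarrow> (nat \<Rightarrow> 'a) \<Rightarrow> bool" where
  "fixed_point \<sigma> d \<longleftrightarrow> flat (smap \<sigma> (smap d nats)) = smap d nats"

definition thue_morse :: "(nat \<Rightarrow> int) \<Rightarrow> bool" where
  "thue_morse d \<longleftrightarrow> d 0 = 1 \<and> (\<forall>n. d (2 * n) = d n \<and> d (2 * n + 1) = - d n)"

lemma flat_constant_length:
  assumes "0 < p" "\<forall>w\<in>sset ws. length w = p"
  shows "flat ws !! n = (ws !! (n div p)) ! (n mod p)"
  using assms(2)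
proof (induction n arbitrary: ws rule: less_induct)
  case (less n)
  have ne: "\<forall>w\<in>sset ws. w \<noteq> []" using less.prems \<open>0 < p\<close> by auto
  have len: "length (shd ws) = p" using less.prems by (simp add: shd_sset)
  show ?case
  proof (cases "n < p")
    case True
    then show ?thesis using flat_snth[OF ne, of n] len by simp
  next
    case False
    have "flat ws !! n = flat (stl ws) !! (n - p)"
      using flat_snth[OF ne, of n] len False by simp
    also have "\<dots> = (stl ws !! ((n - p) div p)) ! ((n - p) mod p)"
      using less.prems False \<open>0 < p\<close> by (intro less.IH) (auto dest: stl_sset)
    also have "\<dots> = (ws !! (n div p)) ! (n mod p)"
      using False \<open>0 < p\<close> by (simp add: le_div_geq le_mod_geq)
    finally show ?thesis .
  qed
qed

lemma pow2_dvd_hankel_det: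
  assumes "\<forall>n. d n \<in> {-1, 1}" "n \<ge> 1"
  shows "2 ^ (n - 1) dvd hankel_det d n"
proof -
  define A where "A = mat n n (\<lambda>(i, j). d (i + j))"
  define E :: "int mat" where
    "E = mat n n (\<lambda>(i, j). if i = j then 1 else if j = 0 then -1 else 0)"
  define D :: "int mat" where
    "D = mat n n (\<lambda>(i, j). if i = j then (if i = 0 then 1 else 2) else 0)"
  define B where
    "B = mat n n (\<lambda>(i, j). if i = 0 then d j else (d (i + j) - d j) div 2)"
  have carr: "A \<in> carrier_mat n n" "E \<in> carrier_mat n n" "D \<in> carrier_mat n n"
    "B \<in> carrier_mat n n"
    by (auto simp: A_def E_def D_def B_def)
  have even: "2 * ((d i - d j) div 2) = d i - d j" for i j
    using assms(1)[rule_format, of i] assms(1)[rule_format, of j] by auto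
  have EA: "(\<Sum>k = 0..<n. (if i = k then 1 else if k = 0 then -1 else 0) * d (k + j)) =
      (if i = 0 then d j else d (i + j) - d j)" if "i < n" for i j
  proof -
    have "(\<Sum>k = 0..<n. (if i = k then 1 else if k = 0 then -1 else 0) * d (k + j)) =
        (\<Sum>k = 0..<n. (if k = i then d (k + j) else 0)
          + (if k = 0 then (if i = 0 then 0 else - d (k + j)) else 0))"
      by (intro sum.cong) auto
    also have "\<dots> = (if i = 0 then d j else d (i + j) - d j)"
      using that by (simp add: sum.distrib)
    finally show ?thesis .
  qed
  have DB: "(\<Sum>k = 0..<n. (if i = k then (if i = 0 then 1 else 2) else 0) * b k) =
      (if i = 0 then 1 else 2) * b i" if "i < n" for i and b :: "nat \<Rightarrow> int"
  proof -
    have "(\<Sum>k = 0..<n. (if i = k then (if i = 0 then 1 else 2) else 0) * b k) =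
        (\<Sum>k = 0..<n. if k = i then (if i = 0 then 1 else 2) * b k else 0)"
      by (intro sum.cong) auto
    then show ?thesis using that by simp
  qed
  have "E * A = D * B"
  proof (rule eq_matI)
    fix i j assume "i < dim_row (D * B)" "j < dim_col (D * B)"
    then have ij: "i < n" "j < n" by (auto simp: D_def B_def)
    have "(E * A) $$ (i, j) =
        (\<Sum>k = 0..<n. (if i = k then 1 else if k = 0 then -1 else 0) * d (k + j))"
      using ij by (simp add: E_def A_def scalar_prod_def)
    moreover have "(D * B) $$ (i, j) =
        (\<Sum>k = 0..<n. (if i = k then (if i = 0 then 1 else 2) else 0) *
          (if k = 0 then d j else (d (k + j) - d j) div 2))"
      using ij by (simp add: D_def B_def scalar_prod_def)
    ultimately show "(E * A) $$ (i, j) = (D * B) $$ (i, j)"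
      using EA[OF ij(1), of j] DB[OF ij(1)] even by simp
  qed (simp_all add: E_def A_def D_def B_def)
  moreover have "det E = 1"
  proof -
    have "det E = prod_list (diag_mat E)"
      by (rule det_lower_triangular[OF _ carr(2)]) (auto simp: E_def)
    also have "diag_mat E = replicate n 1"
      by (rule nth_equalityI) (auto simp: diag_mat_def E_def)
    finally show ?thesis by simp
  qed
  moreover have "det D = 2 ^ (n - 1)"
  proof -
    have "det D = prod_list (diag_mat D)"
      by (rule det_lower_triangular[OF _ carr(3)]) (auto simp: D_def)
    also have "diag_mat D = 1 # replicate (n - 1) 2"
      using assms(2) by (intro nth_equalityI) (auto simp: diag_mat_def D_def nth_Cons split: nat.split)
    finally show ?thesis by simp
  qed
  ultimately have "det A = 2 ^ (n - 1) * det B"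
    using det_mult[OF carr(2,1)] det_mult[OF carr(3,4)] by simp
  then show ?thesis by (simp add: hankel_det_def A_def)
qed

end

theory Submission
  imports Defs "HOL-Library.Z2" "HOL-Computational_Algebra.Formal_Power_Series"
begin

text \<open>Put \<open>e k = (d k - d (k + 2)) / 2\<close> modulo 2. Row and column differences reduce
  \<open>H\<^sub>n(d) / 2\<^bsup>n-1\<^esup>\<close> modulo 2 to \<open>H\<^bsub>n-1\<^esub>(e)\<close>. Over the field with two elements, all Hankel
  determinants of \<open>e\<close> are nonzero iff \<open>e 0 = 1\<close> and \<open>e (2 k + 2) = e (2 k + 1) + e k\<close> (the
  characterization of perfect linear complexity profiles by Wang and Massey): the recurrence
  excludes kernel vectors by a descent, and conversely the determinant of order \<open>n + 1\<close> is affine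
  in \<open>e (2 n)\<close> with nonzero slope, so it forces the value of \<open>e (2 n)\<close>. In terms of \<open>d\<close> this says
  that \<open>d n * d (n + 1) * d (2 n + 1) * d (2 n + 2) = -1\<close> for all \<open>n\<close>. For odd \<open>p\<close> the positions
  \<open>2 n + 1\<close> and \<open>2 n + 2\<close> lie in one block of length \<open>p\<close> whenever \<open>n\<close> and \<open>n + 1\<close> do, and the
  remaining conditions reproduce those for smaller \<open>n\<close>. For even \<open>p\<close> the positions that straddle
  two blocks force \<open>d (2 m) * d (2 m + 1)\<close> to be constant, which leads to the Thue-Morse
  sequence.\<close>

section \<open>Sums and power series over the field with two elements\<close>

declare add_bit_eq_xor [simp del] mult_bit_eq_and [simp del]

lemma bit_add_self: "x + x = (0 :: bit)"
  by (cases x) simp_all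

lemma of_int_bit_eq_1_iff: "of_int x = (1 :: bit) \<longleftrightarrow> odd x"
proof (cases "even x")
  case True
  then show ?thesis by (auto elim!: evenE)
next
  case False
  then show ?thesis by (auto elim!: oddE)
qed

text \<open>The reflection \<open>i\<close> to \<open>m - i\<close> pairs equal terms, which cancel
  modulo 2; only a fixed point survives.\<close>

lemma sum_symmetric_bit:
  fixes g :: "nat \<Rightarrow> bit"
  assumes sym: "\<And>i. i \<le> m \<Longrightarrow> g (m - i) = g i"
  shows "(\<Sum>i=0..m. g i) = (if even m then g (m div 2) else 0)"
proof -
  define L where "L = {i. 2 * i < m}"
  define M where "M = {i. 2 * i = m}"
  define R where "R = {i. i \<le> m \<and> m < 2 * i}"
  have "L \<subseteq> {0..m}" "M \<subseteq> {0..m}" "R \<subseteq> {0..m}"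
    by (auto simp: L_def M_def R_def)
  then have fin: "finite L" "finite M" "finite R"
    by (meson finite_atLeastAtMost finite_subset)+
  have "{0..m} = (L \<union> R) \<union> M"
    by (auto simp: L_def M_def R_def)
  then have "sum g {0..m} = sum g ((L \<union> R) \<union> M)"
    by simp
  also have "\<dots> = sum g (L \<union> R) + sum g M"
    using fin by (intro sum.union_disjoint) (auto simp: L_def M_def R_def)
  also have "sum g (L \<union> R) = sum g L + sum g R"
    using fin by (intro sum.union_disjoint) (auto simp: L_def R_def)
  also have "sum g R = sum g L"
    by (rule sum.reindex_bij_witness[where i = "\<lambda>i. m - i" and j = "\<lambda>i. m - i"])
      (auto simp: L_def R_def sym)
  also have "sum g M = (if even m then g (m div 2) else 0)"
  proof (cases "even m")
    case True
    then have "M = {m div 2}" by (auto simp: M_def)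
    with True show ?thesis by simp
  next
    case False
    then have "M = {}" by (auto simp: M_def)
    with False show ?thesis by simp
  qed
  finally show ?thesis by (simp add: bit_add_self)
qed

lemma fps_square_nth_bit:
  fixes f :: "bit fps"
  shows "fps_nth (f * f) m = (if even m then fps_nth f (m div 2) else 0)"
proof -
  have "fps_nth (f * f) m = (\<Sum>i=0..m. fps_nth f i * fps_nth f (m - i))"
    by (simp add: fps_mult_nth)
  also have "\<dots> = (if even m then fps_nth f (m div 2) * fps_nth f (m - m div 2) else 0)"
    by (rule sum_symmetric_bit) (simp add: mult.commute)
  also have "\<dots> = (if even m then fps_nth f (m div 2) else 0)"
  proof (cases "even m")
    case True
    then have "m - m div 2 = m div 2" by auto
    then show ?thesis by (cases "fps_nth f (m div 2)") simp_all
  qed simp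
  finally show ?thesis .
qed

text \<open>The quadratic form \<open>X\<^sup>2 P\<^sup>2 + (1 + X) P Q + Q\<^sup>2\<close> is anisotropic modulo odd powers: its top even
  coefficient is \<open>a\<^sup>2 + a b + b\<^sup>2\<close> in the top coefficients \<open>a\<close>, \<open>b\<close> of \<open>P\<close> and \<open>Q\<close>, and this
  vanishes over the field with two elements only for \<open>a = b = 0\<close>.\<close>

lemma even_part_form_anisotropic:
  fixes P Q :: "bit fps"
  assumes "\<And>i. n \<le> i \<Longrightarrow> fps_nth Q i = 0"
    and "\<And>i. n \<le> Suc i \<Longrightarrow> fps_nth P i = 0"
    and "\<And>k. k < n \<Longrightarrow>
      fps_nth ((fps_X * P) * (fps_X * P) + fps_X * (P * Q) + P * Q + Q * Q) (2 * k) = 0"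
  shows "Q = 0"
  using assms
proof (induction n)
  case 0
  then show ?case by (simp add: fps_eq_iff)
next
  case (Suc n)
  \<comment> \<open>For positive \<open>n\<close> the degrees of \<open>P\<close> and
    \<open>Q\<close> are at most \<open>n - 1\<close> and \<open>n\<close>, so \<open>P * Q\<close>
    stops at \<open>2 * n - 1\<close>; in degree \<open>2 * n\<close> only its shift by
    \<open>fps_X\<close> contributes.\<close>
  have top: "fps_nth Q n = 0 \<and> (\<forall>m. n = Suc m \<longrightarrow> fps_nth P m = 0)"
  proof (cases n)
    case 0
    have "P = 0" using Suc.prems(2) 0 by (simp add: fps_eq_iff)
    then show ?thesis using Suc.prems(3)[of 0] 0 by (simp add: fps_square_nth_bit)
  next
    case (Suc m)
    have P0: "fps_nth P i = 0" if "m < i" for i using Suc.prems(2) that Suc by simp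
    have Q0: "fps_nth Q i = 0" if "Suc m < i" for i using Suc.prems(1) that Suc by simp
    have a: "fps_nth (P * Q) (2 * n) = 0"
    proof -
      have "fps_nth P i * fps_nth Q (2 * n - i) = 0" for i
        using P0[of i] Q0[of "2 * n - i"] Suc by (cases "m < i") auto
      then show ?thesis by (simp only: fps_mult_nth sum.neutral_const)
    qed
    have b: "fps_nth (P * Q) (2 * n - 1) = fps_nth P m * fps_nth Q n"
    proof -
      have "fps_nth P i * fps_nth Q (2 * n - 1 - i) = 0" if "i \<noteq> m" for i
        using P0[of i] Q0[of "2 * n - 1 - i"] Suc that by (cases "m < i") auto
      then have "(\<Sum>i=0..2 * n - 1. fps_nth P i * fps_nth Q (2 * n - 1 - i)) =
          (\<Sum>i\<in>{m}. fps_nth P i * fps_nth Q (2 * n - 1 - i))"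
        using Suc by (intro sum.mono_neutral_right) auto
      also have "\<dots> = fps_nth P m * fps_nth Q n"
        using Suc by simp
      finally show ?thesis by (simp add: fps_mult_nth)
    qed
    have "fps_nth P m + fps_nth P m * fps_nth Q n + fps_nth Q n = 0"
      using Suc.prems(3)[of n] a b Suc by (simp add: fps_square_nth_bit)
    then show ?thesis using Suc
      by (cases "fps_nth P m"; cases "fps_nth Q n") auto
  qed
  show ?case
  proof (rule Suc.IH)
    show "fps_nth Q i = 0" if "n \<le> i" for i
      using that top Suc.prems(1)[of i] by (cases "i = n") auto
    show "fps_nth P i = 0" if "n \<le> Suc i" for i
      using that top Suc.prems(2)[of i] by (cases "n = Suc i") auto
  qed (use Suc.prems(3) in auto)
qed

section \<open>Hankel determinants over the field with two elements\<close>

definition hankel_mat :: "(nat \<Rightarrow> 'a) \<Rightarrow> nat \<Rightarrow> 'a mat" where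
  "hankel_mat a n = mat n n (\<lambda>(i, j). a (i + j))"

lemma hankel_mat_carrier [simp]: "hankel_mat a n \<in> carrier_mat n n"
  by (simp add: hankel_mat_def)

lemma fps_mult_nth_cong:
  assumes "\<And>i. i \<le> m \<Longrightarrow> fps_nth F i = fps_nth G i"
  shows "fps_nth (F * H) m = fps_nth (G * H) m"
  unfolding fps_mult_nth using assms by (intro sum.cong) auto

text \<open>A kernel vector of the Hankel matrix, read as a series \<open>Q\<close>, gives a Pade approximation
  \<open>P\<close> of \<open>Q g\<close>, where \<open>g = \<Sum>k. e k X\<^sup>k\<close>. The recurrence says that \<open>X\<^sup>2 g\<^sup>2 + (1 + X) g + 1\<close> has
  no even powers; multiplying by the even series \<open>Q\<^sup>2\<close> transfers this to the form in \<open>P\<close> and \<open>Q\<close>.\<close>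

lemma det_hankel_mat_bit:
  fixes e :: "nat \<Rightarrow> bit"
  assumes e0: "e 0 = 1"
    and rec: "\<And>k. Suc k < n \<Longrightarrow> e (2 * k + 2) = e (2 * k + 1) + e k"
  shows "det (hankel_mat e n) = 1"
proof (rule ccontr)
  assume "det (hankel_mat e n) \<noteq> 1"
  then have "det (hankel_mat e n) = 0" by simp
  then obtain w where w: "w \<in> carrier_vec n" "w \<noteq> 0\<^sub>v n" "hankel_mat e n *\<^sub>v w = 0\<^sub>v n"
    using det_0_iff_vec_prod_zero[OF hankel_mat_carrier] by blast
  have ker: "(\<Sum>j<n. e (i + j) * (w $ j)) = 0" if "i < n" for i
  proof -
    have "(hankel_mat e n *\<^sub>v w) $ i = (\<Sum>j<n. e (i + j) * (w $ j))"
      using that w(1) by (simp add: hankel_mat_def scalar_prod_def atLeast0LessThan)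
    then show ?thesis using w(3) that by simp
  qed
  define g where "g = Abs_fps e"
  \<comment> \<open>Reversing \<open>w\<close> turns row \<open>i\<close> of the kernel equation
    into the coefficient of \<open>Q * g\<close> at \<open>n - 1 + i\<close>.\<close>
  define Q where "Q = Abs_fps (\<lambda>i. if i < n then w $ (n - 1 - i) else 0)"
  define P where "P = Abs_fps (\<lambda>i. if Suc i < n then fps_nth (Q * g) i else 0)"
  have gap: "fps_nth (Q * g) (n - 1 + i) = 0" if "i < n" for i
  proof -
    have "fps_nth (Q * g) (n - 1 + i) =
        (\<Sum>l=0..n - 1 + i. fps_nth Q l * fps_nth g (n - 1 + i - l))"
      by (simp add: fps_mult_nth)
    also have "\<dots> = (\<Sum>l<n. fps_nth Q l * fps_nth g (n - 1 + i - l))"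
      using that by (intro sum.mono_neutral_right) (auto simp: Q_def)
    also have "\<dots> = (\<Sum>j<n. e (i + j) * (w $ j))"
      by (rule sum.reindex_bij_witness[where i = "\<lambda>j. n - 1 - j" and j = "\<lambda>j. n - 1 - j"])
        (auto simp: Q_def g_def mult.commute add.commute)
    finally show ?thesis using ker[OF that] by simp
  qed
  \<comment> \<open>The gap covers degrees \<open>n - 1\<close> to \<open>2 * n - 2\<close>, so the
    truncation \<open>P\<close> is exact up to the largest index \<open>2 * k\<close> needed
    below.\<close>
  have PQ: "fps_nth P i = fps_nth (Q * g) i" if "i \<le> 2 * n - 2" "n > 0" for i
  proof (cases "Suc i < n")
    case False
    then have "i = n - 1 + (i - (n - 1))" "i - (n - 1) < n" using that by auto
    with gap[of "i - (n - 1)"] False show ?thesis by (simp add: P_def)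
  qed (simp add: P_def)
  define h where "h = (fps_X * g) * (fps_X * g) + fps_X * g + g + 1"
  have h_even: "fps_nth h (2 * k) = 0" if "k < n" for k
  proof (cases k)
    case 0
    then show ?thesis by (simp add: h_def g_def e0)
  next
    case (Suc m)
    with rec[of m] that show ?thesis
      by (simp add: h_def g_def fps_square_nth_bit)
  qed
  have Qh: "fps_nth ((Q * Q) * h) (2 * k) = 0" if "k < n" for k
  proof -
    have "fps_nth (Q * Q) i * fps_nth h (2 * k - i) = 0" if "i \<le> 2 * k" for i
    proof (cases "even i")
      case True
      then obtain l where "i = 2 * l" by (elim evenE)
      with h_even[of "k - l"] \<open>k < n\<close> show ?thesis by (simp flip: diff_mult_distrib2)
    qed (simp add: fps_square_nth_bit)
    then show ?thesis unfolding fps_mult_nth by (intro sum.neutral) auto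
  qed
  have expand: "(Q * Q) * h = (fps_X * (Q * g)) * (fps_X * (Q * g)) + fps_X * ((Q * g) * Q)
      + (Q * g) * Q + Q * Q"
    by (simp add: h_def algebra_simps)
  have "Q = 0"
  proof (rule even_part_form_anisotropic[where n = n])
    fix k assume k: "k < n"
    have le: "i \<le> 2 * k \<Longrightarrow> fps_nth P i = fps_nth (Q * g) i" for i
      using PQ[of i] k by auto
    have "fps_nth ((fps_X * P) * (fps_X * P)) (2 * k) =
        fps_nth ((fps_X * (Q * g)) * (fps_X * (Q * g))) (2 * k)"
      using le[of "k - 1"] by (simp add: fps_square_nth_bit)
    moreover have "fps_nth (P * Q) i = fps_nth ((Q * g) * Q) i" if "i \<le> 2 * k" for i
      using that by (intro fps_mult_nth_cong le) auto
    ultimately have "fps_nth ((fps_X * P) * (fps_X * P) + fps_X * (P * Q) + P * Q + Q * Q) (2 * k)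
        = fps_nth ((Q * Q) * h) (2 * k)"
      unfolding expand by simp
    then show "fps_nth ((fps_X * P) * (fps_X * P) + fps_X * (P * Q) + P * Q + Q * Q) (2 * k) = 0"
      using Qh[OF k] by simp
  qed (auto simp: Q_def P_def)
  have "w $ j = 0" if "j < n" for j
  proof -
    have "fps_nth Q (n - 1 - j) = w $ j" using that by (simp add: Q_def)
    then show ?thesis using \<open>Q = 0\<close> by simp
  qed
  then have "w = 0\<^sub>v n" using w(1) by (intro eq_vecI) auto
  with w(2) show False by simp
qed

text \<open>The matrices differ only in the bottom right corner, so expansion along the last row
  leaves that difference times the leading minor.\<close>

lemma det_hankel_mat_Suc_diff:
  fixes a b :: "nat \<Rightarrow> 'a :: comm_ring_1"
  assumes agree: "\<And>i. i < 2 * n \<Longrightarrow> a i = b i"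
  shows "det (hankel_mat a (Suc n)) - det (hankel_mat b (Suc n)) =
    (a (2 * n) - b (2 * n)) * det (hankel_mat a n)"
proof -
  let ?A = "hankel_mat a (Suc n)" and ?B = "hankel_mat b (Suc n)"
  have del: "mat_delete ?A n j = mat_delete ?B n j" if "j \<le> n" for j
    using that by (intro eq_matI) (auto simp: mat_delete_def hankel_mat_def intro!: agree)
  have "mat_delete ?A n n = hankel_mat a n"
    by (intro eq_matI) (auto simp: mat_delete_def hankel_mat_def)
  then have corner: "cofactor ?A n n = det (hankel_mat a n)"
    by (simp add: cofactor_def flip: mult_2)
  have "det ?A - det ?B =
      (\<Sum>j<Suc n. ?A $$ (n, j) * cofactor ?A n j) - (\<Sum>j<Suc n. ?B $$ (n, j) * cofactor ?B n j)"
    by (simp only: laplace_expansion_row[OF hankel_mat_carrier lessI])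
  also have "\<dots> = (\<Sum>j<Suc n. (a (n + j) - b (n + j)) * cofactor ?A n j)"
    using del by (simp add: sum_subtractf[symmetric] cofactor_def hankel_mat_def algebra_simps)
  also have "\<dots> = (a (2 * n) - b (2 * n)) * cofactor ?A n n"
    using agree by (simp add: mult_2)
  finally show ?thesis by (simp add: corner)
qed

lemma all_det_hankel_mat_bit_iff:
  fixes e :: "nat \<Rightarrow> bit"
  shows "(\<forall>n. det (hankel_mat e n) = 1) \<longleftrightarrow>
    e 0 = 1 \<and> (\<forall>k. e (2 * k + 2) = e (2 * k + 1) + e k)"
proof
  assume det1: "\<forall>n. det (hankel_mat e n) = 1"
  have "det (hankel_mat e 1) = e 0"
    by (subst det_single) (auto simp: hankel_mat_def)
  then have e0: "e 0 = 1" using det1 by metis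
  have "e (2 * k + 2) = e (2 * k + 1) + e k" for k
  proof (induction k rule: less_induct)
    case (less k)
    \<comment> \<open>\<open>e'\<close> carries the value that the recurrence prescribes at
      \<open>2 * k + 2\<close>, so its determinant is 1 as well; the comparison of corners then
      forces \<open>e\<close> to agree with it.\<close>
    define e' where "e' = e(2 * k + 2 := e (2 * k + 1) + e k)"
    have "det (hankel_mat e' (Suc (Suc k))) = 1"
    proof (rule det_hankel_mat_bit)
      show "e' 0 = 1" by (simp add: e'_def e0)
      show "e' (2 * l + 2) = e' (2 * l + 1) + e' l" if "Suc l < Suc (Suc k)" for l
        using that less.IH[of l] by (cases "l = k") (auto simp: e'_def)
    qed
    moreover have "det (hankel_mat e (Suc (Suc k))) - det (hankel_mat e' (Suc (Suc k))) =
        (e (2 * Suc k) - e' (2 * Suc k)) * det (hankel_mat e (Suc k))"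
      by (rule det_hankel_mat_Suc_diff) (auto simp: e'_def)
    ultimately have "e (2 * Suc k) - e' (2 * Suc k) = 0"
      using det1 by (metis diff_self mult_1_right)
    then show ?case by (simp only: right_minus_eq) (simp add: e'_def)
  qed
  with e0 show "e 0 = 1 \<and> (\<forall>k. e (2 * k + 2) = e (2 * k + 1) + e k)" by simp
qed (auto intro: det_hankel_mat_bit)

section \<open>From Hankel determinants of signs to a product criterion\<close>

text \<open>Successive differences of rows and columns split off a factor 2 from every row but the last;
  modulo 2 the remaining last row is \<open>(0, \<dots>, 0, 1)\<close>.\<close>

lemma of_int_hankel_det_div:
  assumes pm: "\<And>n. d n \<in> {-1, 1}"
  shows "(of_int (hankel_det d (Suc m) div 2 ^ m) :: bit) =
    det (hankel_mat (\<lambda>k. of_int ((d k - d (k + 2)) div 2)) m)"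
proof -
  define N where "N = Suc m"
  define A where "A = hankel_mat d N"
  \<comment> \<open>Multiplication by \<open>L\<close> on the left takes differences of rows, by its
    transpose on the right differences of columns.\<close>
  define L :: "int mat" where
    "L = mat N N (\<lambda>(i, j). if j = i then 1 else if j = Suc i then -1 else 0)"
  define D :: "int mat" where
    "D = mat N N (\<lambda>(i, j). if j = i then (if i < m then 2 else 1) else 0)"
  define r where "r i j = (if i < m then (d (i + j) - d (Suc (i + j))) div 2 else d (i + j))" for i j
  define R where "R = mat N N (\<lambda>(i, j). r i j)"
  define B where "B = mat N N (\<lambda>(i, j). if j < m then r i j - r i (Suc j) else r i j)"
  have carr: "A \<in> carrier_mat N N" "L \<in> carrier_mat N N" "D \<in> carrier_mat N N"
    "R \<in> carrier_mat N N" "B \<in> carrier_mat N N" "L\<^sup>T \<in> carrier_mat N N"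
    by (auto simp: A_def L_def D_def R_def B_def)
  have halve: "2 * ((d i - d j) div 2) = d i - d j" for i j
    using pm[of i] pm[of j] by auto
  have diff_sum: "(\<Sum>k=0..<N. (if k = i then 1 else if k = Suc i then -1 else 0) * x k) =
      (if i < m then x i - x (Suc i) else x i)" if "i < N" for i and x :: "nat \<Rightarrow> int"
  proof -
    have "(\<Sum>k=0..<N. (if k = i then 1 else if k = Suc i then -1 else 0) * x k) =
        (\<Sum>k=0..<N. (if k = i then x k else 0) + (if k = Suc i then - x k else 0))"
      by (intro sum.cong) auto
    then show ?thesis using that by (auto simp: sum.distrib N_def less_Suc_eq)
  qed
  have diag_sum: "(\<Sum>k=0..<N. (if k = i then y else 0) * x k) = y * x i"
    if "i < N" for i y and x :: "nat \<Rightarrow> int"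
  proof -
    have "(\<Sum>k=0..<N. (if k = i then y else 0) * x k) = (\<Sum>k=0..<N. if k = i then y * x k else 0)"
      by (intro sum.cong) auto
    then show ?thesis using that by simp
  qed
  have "L * A = D * R"
  proof (rule eq_matI)
    fix i j assume "i < dim_row (D * R)" "j < dim_col (D * R)"
    then have ij: "i < N" "j < N" by (auto simp: D_def R_def)
    have "(L * A) $$ (i, j) =
        (\<Sum>k=0..<N. (if k = i then 1 else if k = Suc i then -1 else 0) * d (k + j))"
      using ij by (simp add: L_def A_def hankel_mat_def scalar_prod_def)
    moreover have "(D * R) $$ (i, j) =
        (\<Sum>k=0..<N. (if k = i then (if i < m then 2 else 1) else 0) * r k j)"
      using ij by (simp add: D_def R_def scalar_prod_def)
    ultimately show "(L * A) $$ (i, j) = (D * R) $$ (i, j)"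
      using diff_sum[OF ij(1), of "\<lambda>k. d (k + j)"]
        diag_sum[OF ij(1), of "if i < m then 2 else 1" "\<lambda>k. r k j"]
      by (simp add: r_def halve)
  qed (simp_all add: L_def A_def D_def R_def hankel_mat_def)
  moreover have "R * L\<^sup>T = B"
  proof (rule eq_matI)
    fix i j assume "i < dim_row B" "j < dim_col B"
    then have ij: "i < N" "j < N" by (auto simp: B_def)
    have "(R * L\<^sup>T) $$ (i, j) =
        (\<Sum>k=0..<N. (if k = j then 1 else if k = Suc j then -1 else 0) * r i k)"
      using ij by (simp add: L_def R_def scalar_prod_def mult.commute)
    then show "(R * L\<^sup>T) $$ (i, j) = B $$ (i, j)"
      using diff_sum[OF ij(2), of "r i"] ij by (simp add: B_def)
  qed (simp_all add: L_def R_def B_def)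
  moreover have detL: "det L = 1"
  proof -
    have "det L = prod_list (diag_mat L)"
      by (rule det_upper_triangular[OF _ carr(2)]) (auto simp: L_def)
    also have "diag_mat L = replicate N 1"
      by (rule nth_equalityI) (auto simp: diag_mat_def L_def)
    finally show ?thesis by simp
  qed
  moreover have "det D = 2 ^ m"
  proof -
    have "det D = prod_list (diag_mat D)"
      by (rule det_lower_triangular[OF _ carr(3)]) (auto simp: D_def)
    also have "diag_mat D = replicate m 2 @ [1]"
      by (rule nth_equalityI) (auto simp: diag_mat_def D_def N_def nth_append)
    finally show ?thesis by simp
  qed
  ultimately have "det A = 2 ^ m * det B"
    using det_mult[OF carr(2,1)] det_mult[OF carr(3,4)] det_mult[OF carr(4,6)]
      det_transpose[OF carr(2)] by simp
  then have det_div: "hankel_det d (Suc m) div 2 ^ m = det B"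
    by (simp add: hankel_det_def A_def hankel_mat_def N_def)
  define C :: "bit mat" where "C = map_mat of_int B"
  have C: "C \<in> carrier_mat (Suc m) (Suc m)" using carr(5) by (simp add: C_def N_def)
  have "of_int (det B) = det C"
    by (simp add: C_def of_int_hom.hom_det)
  also have "\<dots> = (\<Sum>j<Suc m. C $$ (m, j) * cofactor C m j)"
    by (rule laplace_expansion_row[OF C]) simp
  also have "\<dots> = cofactor C m m"
  proof -
    have "C $$ (m, j) = 0" if "j < m" for j
    proof -
      have "C $$ (m, j) = of_int (d (m + j) - d (Suc (m + j)))"
        using that by (simp add: C_def B_def N_def r_def)
      also have "\<dots> = 0"
        using pm[of "m + j"] pm[of "Suc (m + j)"] by auto
      finally show ?thesis .
    qed
    moreover have "C $$ (m, m) = 1"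
      using pm[of "m + m"] by (auto simp: C_def B_def N_def r_def)
    ultimately show ?thesis by simp
  qed
  also have "\<dots> = det (mat_delete C m m)"
    by (simp add: cofactor_def)
  also have "mat_delete C m m = hankel_mat (\<lambda>k. of_int ((d k - d (k + 2)) div 2)) m"
  proof (rule eq_matI)
    fix i j assume "i < dim_row (hankel_mat (\<lambda>k. of_int ((d k - d (k + 2)) div 2) :: bit) m)"
      "j < dim_col (hankel_mat (\<lambda>k. of_int ((d k - d (k + 2)) div 2) :: bit) m)"
    then have ij: "i < m" "j < m" by (auto simp: hankel_mat_def)
    have "mat_delete C m m $$ (i, j) = of_int (r i j - r i (Suc j))"
      using ij carr(5) by (simp add: mat_delete_def C_def B_def N_def)
    \<comment> \<open>With \<open>k = i + j\<close>, the second difference is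
      \<open>(d k + d (k + 2)) / 2 - d (k + 1)\<close>; it exceeds the claimed entry by the even
      number \<open>d (k + 2) - d (k + 1)\<close>.\<close>
    also have "\<dots> = of_int ((d (i + j) - d (i + j + 2)) div 2)"
      using ij pm[of "i + j"] pm[of "i + j + 1"] pm[of "i + j + 2"]
      by (auto simp: r_def)
    finally show "mat_delete C m m $$ (i, j) =
        hankel_mat (\<lambda>k. of_int ((d k - d (k + 2)) div 2)) m $$ (i, j)"
      using ij by (simp add: hankel_mat_def)
  qed (use carr(5) in \<open>auto simp: mat_delete_def C_def N_def hankel_mat_def\<close>)
  finally show ?thesis by (simp only: det_div)
qed

lemma apwenian_iff:
  assumes pm: "\<And>n. d n \<in> {-1, 1}"
  shows "apwenian d \<longleftrightarrow> (\<forall>n. d n * d (n + 1) * d (2 * n + 1) * d (2 * n + 2) = -1)"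
proof -
  define e :: "nat \<Rightarrow> bit" where "e k = of_int ((d k - d (k + 2)) div 2)" for k
  define f where "f n = d n * d (n + 1) * d (2 * n + 1) * d (2 * n + 2)" for n
  have "apwenian d \<longleftrightarrow> (\<forall>m. odd (hankel_det d (Suc m) div 2 ^ m))"
  proof -
    have "(\<forall>n\<ge>1. [hankel_det d n div 2 ^ (n - 1) = 1] (mod 2)) \<longleftrightarrow>
        (\<forall>m. [hankel_det d (Suc m) div 2 ^ m = 1] (mod 2))"
      by (metis One_nat_def Suc_le_D diff_Suc_1 le_add1 plus_1_eq_Suc)
    then show ?thesis using pm by (simp add: apwenian_def cong_def odd_iff_mod_2_eq_one)
  qed
  also have "\<dots> \<longleftrightarrow> (\<forall>m. det (hankel_mat e m) = 1)"
    using of_int_hankel_det_div[OF pm] by (simp add: e_def[abs_def] flip: of_int_bit_eq_1_iff)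
  also have "\<dots> \<longleftrightarrow> e 0 = 1 \<and> (\<forall>k. e (2 * k + 2) = e (2 * k + 1) + e k)"
    by (rule all_det_hankel_mat_bit_iff)
  also have "e 0 = 1 \<longleftrightarrow> f 0 = -1"
    using pm[of 0] pm[of 1] pm[of 2] by (auto simp: e_def f_def numeral_2_eq_2)
  also have "(\<forall>k. e (2 * k + 2) = e (2 * k + 1) + e k) \<longleftrightarrow> (\<forall>k. f (Suc k) = f k)"
  proof (rule iff_allI)
    fix k
    \<comment> \<open>\<open>e i\<close> is the exponent of -1 in \<open>d i * d (i + 2)\<close>, so
      the recurrence becomes multiplicative and says \<open>f k * f (Suc k) = 1\<close>, the square
      of \<open>d (k + 1)\<close> dropping out.\<close>
    have e_cases: "e i = (if d i = d (i + 2) then 0 else 1)" for i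
      using pm[of i] pm[of "i + 2"] by (auto simp: e_def)
    have idx: "2 * k + 2 + 2 = 2 * Suc k + 2" "2 * k + 1 + 2 = 2 * Suc k + 1" "k + 2 = Suc k + 1"
      "2 * k + 3 = 2 * Suc k + 1"
      by auto
    show "e (2 * k + 2) = e (2 * k + 1) + e k \<longleftrightarrow> f (Suc k) = f k"
      unfolding e_cases f_def idx
      using pm[of k] pm[of "Suc k"] pm[of "Suc k + 1"] pm[of "2 * k + 1"] pm[of "2 * k + 2"]
        pm[of "2 * Suc k + 1"] pm[of "2 * Suc k + 2"]
      by (elim insertE emptyE) simp_all
  qed
  also have "f 0 = -1 \<and> (\<forall>k. f (Suc k) = f k) \<longleftrightarrow> (\<forall>n. f n = -1)"
  proof
    assume "f 0 = -1 \<and> (\<forall>k. f (Suc k) = f k)"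
    then have "f n = -1" for n by (induction n) simp_all
    then show "\<forall>n. f n = -1" by blast
  qed simp
  finally show ?thesis by (simp add: f_def)
qed

section \<open>Fixed points of the substitution\<close>

lemma fixed_point_nth:
  assumes "p > 0" "\<And>n. length (\<sigma> (d n)) = p" "fixed_point \<sigma> d"
  shows "d n = \<sigma> (d (n div p)) ! (n mod p)"
proof -
  have "flat (smap \<sigma> (smap d nats)) !! n = smap \<sigma> (smap d nats) !! (n div p) ! (n mod p)"
    using assms(1,2) by (intro flat_constant_length) (auto simp: stream.set_map)
  then show ?thesis using assms(3) by (simp add: fixed_point_def)
qed

lemma thue_morse_imp_apwenian:
  assumes "thue_morse d" and pm: "\<And>n. d n \<in> {-1, 1}"
  shows "apwenian d"
  unfolding apwenian_iff[OF pm]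
proof
  fix n
  have "d (2 * (n + 1)) = d (n + 1)" "d (2 * n + 1) = - d n"
    using assms(1) unfolding thue_morse_def by blast+
  then show "d n * d (n + 1) * d (2 * n + 1) * d (2 * n + 2) = -1"
    using pm[of n] pm[of "n + 1"] by auto
qed

theorem theorem5p2:
  fixes p :: nat and v :: "nat \<Rightarrow> int" and \<sigma> :: "int \<Rightarrow> int list" and d :: "nat \<Rightarrow> int"
  assumes "p \<ge> 2"
    and "v 0 = 1"
    and "\<And>i. i < p \<Longrightarrow> v i \<in> {-1, 1}"
    and "\<And>n j. j < p \<Longrightarrow> v (n * p + j) = v j"
    and "\<sigma> 1 = map v [0..<p]"
    and "\<sigma> (-1) = map (\<lambda>i. - v i) [0..<p]"
    and "\<And>n. d n \<in> {-1, 1}"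
    and "fixed_point \<sigma> d"
    and "d 0 = 1"
  shows "(odd p \<longrightarrow>
            (apwenian d \<longleftrightarrow>
              (\<forall>j\<le>p - 2. [(v j + v (j + 1) - v (2 * j + 1) - v (2 * j + 2)) div 2 = 1] (mod 2)))) \<and>
         (even p \<longrightarrow> (apwenian d \<longleftrightarrow> thue_morse d))"
proof -
  note pm = assms(7)
  have vpm: "v i \<in> {-1, 1}" for i
    using assms(3)[of "i mod p"] assms(4)[of "i mod p" "i div p"] assms(1) by simp
  have block: "d (n * p + j) = d n * v j" if "j < p" for n j
  proof -
    have "length (\<sigma> (d k)) = p" for k using pm[of k] assms(5,6) by auto
    then have "d (n * p + j) = \<sigma> (d ((n * p + j) div p)) ! ((n * p + j) mod p)"
      using assms(1,8) by (intro fixed_point_nth) auto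
    also have "\<dots> = \<sigma> (d n) ! j" using that by simp
    also have "\<dots> = d n * v j" using pm[of n] assms(5,6) that by auto
    finally show ?thesis .
  qed
  define C where "C n \<longleftrightarrow> d n * d (n + 1) * d (2 * n + 1) * d (2 * n + 2) = -1" for n
  have apw: "apwenian d \<longleftrightarrow> (\<forall>n. C n)"
    unfolding C_def using apwenian_iff[OF pm] .
  show ?thesis
  proof (intro conjI impI)
    assume "odd p"
    define V where "V j \<longleftrightarrow> v j * v (j + 1) * v (2 * j + 1) * v (2 * j + 2) = -1" for j
    have V: "[(v j + v (j + 1) - v (2 * j + 1) - v (2 * j + 2)) div 2 = 1] (mod 2) \<longleftrightarrow> V j" for j
      using vpm[of j] vpm[of "j + 1"] vpm[of "2 * j + 1"] vpm[of "2 * j + 2"]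
      \<comment> \<open>If the signs are written as \<open>1 - 2 * a\<close>, the halved sum is
        congruent to the sum of the four \<open>a\<close> modulo 2, hence odd exactly when the
        product is -1.\<close>
      unfolding V_def by (elim insertE emptyE) (simp_all add: cong_def)
    have inner: "C (n * p + j) \<longleftrightarrow> V j" if "j \<le> p - 2" for n j
    proof -
      have j: "j + 1 < p" using that assms(1) by auto
      have 1: "d (n * p + j) = d n * v j" "d (n * p + j + 1) = d n * v (j + 1)"
        using block[of j n] block[of "j + 1" n] j by (simp_all add: add.assoc)
      have "d (2 * (n * p + j) + 1) * d (2 * (n * p + j) + 2) = v (2 * j + 1) * v (2 * j + 2)"
      proof (cases "2 * j + 2 < p")
        case True
        have idx: "2 * (n * p + j) + 1 = (2 * n) * p + (2 * j + 1)"
          "2 * (n * p + j) + 2 = (2 * n) * p + (2 * j + 2)" by (simp_all add: algebra_simps)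
        have "d (2 * (n * p + j) + 1) = d (2 * n) * v (2 * j + 1)"
          "d (2 * (n * p + j) + 2) = d (2 * n) * v (2 * j + 2)"
          unfolding idx using True by (intro block; simp)+
        then show ?thesis using pm[of "2 * n"] by auto
      next
        case False
        \<comment> \<open>Oddness excludes \<open>2 * j + 2 = p\<close>, the only case in which the
          two letters would straddle blocks; both now lie in the next block.\<close>
        with \<open>odd p\<close> have le: "p \<le> 2 * j + 1" by (cases "2 * j + 2 = p") auto
        define i where "i = 2 * j + 1 - p"
        have i: "2 * j + 1 = p + i" "i + 1 < p" using le j by (auto simp: i_def)
        have idx: "2 * (n * p + j) + 1 = (2 * n + 1) * p + i"
          "2 * (n * p + j) + 2 = (2 * n + 1) * p + (i + 1)"
          using i by (simp_all add: algebra_simps)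
        have "d (2 * (n * p + j) + 1) = d (2 * n + 1) * v i"
          "d (2 * (n * p + j) + 2) = d (2 * n + 1) * v (i + 1)"
          unfolding idx using i by (intro block; simp)+
        moreover have "v (2 * j + 1) = v i" "v (2 * j + 2) = v (i + 1)"
          using i assms(4)[of i 1] assms(4)[of "i + 1" 1] by (simp_all add: add.assoc)
        ultimately show ?thesis using pm[of "2 * n + 1"] by auto
      qed
      then have "d (n * p + j) * d (n * p + j + 1) *
          (d (2 * (n * p + j) + 1) * d (2 * (n * p + j) + 2)) =
          v j * v (j + 1) * (v (2 * j + 1) * v (2 * j + 2))"
        using 1 pm[of n] by auto
      then show ?thesis by (simp add: C_def V_def mult.assoc)
    qed
    \<comment> \<open>At the end of a block the letter \<open>v (p - 1)\<close> enters twice and the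
      next blocks start with \<open>v 0 = 1\<close>, so the condition descends from
      \<open>n * p + (p - 1)\<close> to \<open>n\<close>.\<close>
    have last: "C (n * p + (p - 1)) \<longleftrightarrow> C n" for n
    proof -
      have idx: "n * p + (p - 1) + 1 = (n + 1) * p + 0"
        "2 * (n * p + (p - 1)) + 1 = (2 * n + 1) * p + (p - 1)"
        "2 * (n * p + (p - 1)) + 2 = (2 * n + 2) * p + 0"
        using assms(1) by (auto simp: algebra_simps)
      have "d (n * p + (p - 1)) = d n * v (p - 1)" "d (n * p + (p - 1) + 1) = d (n + 1)"
        "d (2 * (n * p + (p - 1)) + 1) = d (2 * n + 1) * v (p - 1)"
        "d (2 * (n * p + (p - 1)) + 2) = d (2 * n + 2)"
        unfolding idx using assms(1,2) by (subst block; simp)+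
      then show ?thesis using vpm[of "p - 1"] by (auto simp: C_def)
    qed
    have "C n" if "\<forall>j\<le>p - 2. V j" for n
    proof (induction n rule: less_induct)
      case (less n)
      have n: "n = n div p * p + n mod p" by simp
      show ?case
      proof (cases "n mod p = p - 1")
        case True
        then have "n > 0" using assms(1) by (cases n) auto
        then have "n div p < n" using assms(1) by simp
        with less.IH last[of "n div p"] n True show ?thesis by metis
      next
        case False
        have "n mod p < p" using assms(1) by simp
        with False have "n mod p \<le> p - 2" by linarith
        with inner[of "n mod p" "n div p"] that n show ?thesis by metis
      qed
    qed
    moreover have "V j" if "\<forall>n. C n" "j \<le> p - 2" for j
      using inner[of j 0] that by simp
    ultimately show "apwenian d \<longleftrightarrow>
        (\<forall>j\<le>p - 2. [(v j + v (j + 1) - v (2 * j + 1) - v (2 * j + 2)) div 2 = 1] (mod 2))"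
      unfolding apw V by blast
  next
    assume "even p"
    have "thue_morse d" if "apwenian d"
    proof -
      have C: "C n" for n using that apw by blast
      obtain s where s: "p = 2 * s" using \<open>even p\<close> by (elim evenE)
      then have "s \<ge> 1" using assms(1) by simp
      define \<kappa> where "\<kappa> = - (v (s - 1) * v s * v (p - 1))"
      \<comment> \<open>At \<open>n = m p + s - 1\<close> the letters \<open>2 n + 1\<close> and \<open>2 n + 2\<close> straddle two blocks.\<close>
      have const: "d (2 * m + 1) = \<kappa> * d (2 * m)" for m
      proof -
        let ?n = "m * p + (s - 1)"
        have idx: "?n + 1 = m * p + s" "2 * ?n + 1 = (2 * m) * p + (p - 1)"
          "2 * ?n + 2 = (2 * m + 1) * p + 0"
          using s \<open>s \<ge> 1\<close> by (auto simp: algebra_simps)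
        have "d ?n = d m * v (s - 1)" "d (?n + 1) = d m * v s"
          "d (2 * ?n + 1) = d (2 * m) * v (p - 1)" "d (2 * ?n + 2) = d (2 * m + 1)"
          unfolding idx using s \<open>s \<ge> 1\<close> assms(2) by (subst block; simp)+
        then have "(d m * v (s - 1)) * (d m * v s) * (d (2 * m) * v (p - 1)) * d (2 * m + 1) = -1"
          using C[of ?n] by (simp add: C_def)
        then show ?thesis
          using pm[of m] pm[of "2 * m"] pm[of "2 * m + 1"] vpm[of "s - 1"] vpm[of s] vpm[of "p - 1"]
          unfolding \<kappa>_def by (elim insertE emptyE) simp_all
      qed
      have \<kappa>: "\<kappa> \<in> {-1, 1}"
        unfolding \<kappa>_def using vpm[of "s - 1"] vpm[of s] vpm[of "p - 1"] by auto
      define b where "b m = d (2 * m)" for m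
      have bpm: "b m \<in> {-1, 1}" for m using pm by (simp add: b_def)
      \<comment> \<open>In \<open>C (2 * m)\<close> both \<open>b m\<close> and
        \<open>\<kappa>\<close> occur squared, which leaves
        \<open>b (2 * m) * b (2 * m + 1) = -1\<close>.\<close>
      have b_odd: "b (2 * m + 1) = - b (2 * m)" for m
      proof -
        have "d (2 * m + 1) = \<kappa> * b m" "d (2 * (2 * m) + 1) = \<kappa> * b (2 * m)"
          "d (2 * (2 * m) + 2) = b (2 * m + 1)" "d (2 * m) = b m"
          using const[of m] const[of "2 * m"] by (simp_all add: b_def)
        then have "b m * (\<kappa> * b m) * (\<kappa> * b (2 * m)) * b (2 * m + 1) = -1"
          using C[of "2 * m"] by (simp add: C_def)
        then show ?thesis using \<kappa> bpm[of m] bpm[of "2 * m"] bpm[of "2 * m + 1"]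
          by (elim insertE emptyE) simp_all
      qed
      \<comment> \<open>\<open>C (2 * m + 1)\<close> links \<open>b m * b (2 * m + 1)\<close>, which
        is -1 by \<open>b_odd\<close> and induction, to the next pair
        \<open>b (m + 1) * b (2 * m + 2)\<close>.\<close>
      have b_even: "b (2 * m) = b m" for m
      proof (induction m)
        case (Suc m)
        have "d (2 * m + 1) = \<kappa> * b m" "d (2 * (2 * m + 1) + 1) = \<kappa> * b (2 * m + 1)"
          "d (2 * (2 * m + 1) + 2) = b (2 * Suc m)" "d (2 * m + 1 + 1) = b (Suc m)"
          using const[of m] const[of "2 * m + 1"] by (simp_all add: b_def)
        then have "(\<kappa> * b m) * b (Suc m) * (\<kappa> * b (2 * m + 1)) * b (2 * Suc m) = -1"
          using C[of "2 * m + 1"] by (simp add: C_def)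
        then show ?case using \<kappa> b_odd[of m] Suc bpm[of m] bpm[of "Suc m"] bpm[of "2 * Suc m"]
          by (elim insertE emptyE) simp_all
      qed simp
      \<comment> \<open>The first letters of blocks 1 and 2 sit at the even positions
        \<open>2 * s\<close> and \<open>4 * s\<close>, where \<open>b_even\<close> equates them;
        with \<open>C 0\<close> this fixes the sign of \<open>\<kappa>\<close>.\<close>
      have "d 1 = d p" "d 2 = d (2 * p)"
        using block[of 0 1] block[of 0 2] assms(1,2) by simp_all
      moreover have "d p = b s" "d (2 * p) = b (2 * s)" by (simp_all add: b_def s)
      ultimately have "d 1 = d 2" using b_even by simp
      moreover have "d 2 = -1"
        using C[of 0] assms(9) pm[of 1] pm[of 2] by (auto simp: C_def numeral_2_eq_2)
      ultimately have "\<kappa> = -1" using const[of 0] assms(9) by simp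
      have b_d: "b m = d m" for m
      proof (cases "even m")
        case True
        then show ?thesis using b_even by (auto simp: b_def elim!: evenE)
      next
        case False
        then obtain k where "m = 2 * k + 1" by (elim oddE)
        then show ?thesis using b_odd[of k] b_even[of k] const[of k] \<open>\<kappa> = -1\<close> by (simp add: b_def)
      qed
      show ?thesis unfolding thue_morse_def
        using assms(9) b_d const \<open>\<kappa> = -1\<close> by (simp add: b_def)
    qed
    then show "apwenian d \<longleftrightarrow> thue_morse d"
      using thue_morse_imp_apwenian[of d, OF _ pm] by blast
  qed
qed

end
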